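(* Let $X$ and $Y$ be metric spaces and let $f\colon X\to Y$ be a function. Then the local Lipschitz derivative $\mathbb{L}\mathrm{ip} f\colon X\to[0,+\infty]$ is an upper semicontinuous function.
   Context: The metric on a metric space $X$ is written $|\cdot-\cdot|_X$, and $B(x,r)=\{u\in X: |u-x|_X<r\}$. For a function $f\colon X\to Y$ between metric spaces and $x\in X$, the local Lipschitz derivative is $\mathbb{L}\mathrm{ip} f(x)=\limsup_{(u,v)\to(x,x)}\frac{1}{|u-v|_X}|f(u)-f(v)|_Y=\inf_{r>0}\ \sup_{u\ne v\in B(x,r)}\frac{1}{|u-v|_X}|f(u)-f(v)|_Y\in[0,+\infty]$, with the convention $\sup\varnothing=0$ (so it equals $0$ at isolated points). A function $g\colon X\to[-\infty,+\infty]$ is upper semicontinuous if $g^{-1}([-\infty,\gamma))$ is open for every $\gamma\in\mathbb{R}$. *)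

theory Defs
  imports "HOL-Analysis.Analysis"
begin

(* The supremum and infimum are taken in ennreal = [0, \<infinity>], where the supremum of the
   empty set is 0; in ereal it would be -\<infinity>.  In particular the value at an isolated
   point is 0. *)
definition local_Lip :: "('a::metric_space \<Rightarrow> 'b::metric_space) \<Rightarrow> 'a \<Rightarrow> ennreal" where
  "local_Lip f x =
     (INF r\<in>{0<..}. SUP (u, v)\<in>{(u, v). u \<in> ball x r \<and> v \<in> ball x r \<and> u \<noteq> v}.
        ennreal (dist (f u) (f v) / dist u v))"

definition upper_semicontinuous :: "('a::topological_space \<Rightarrow> ereal) \<Rightarrow> bool" where
  "upper_semicontinuous g \<longleftrightarrow> (\<forall>\<gamma>::real. open (g -` {..<ereal \<gamma>}))"

end

theory Submission
  imports Defs
begin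

text \<open>If the infimum defining \<open>local_Lip f x\<close> is below \<open>c\<close>, then a
  single radius \<open>r\<close> already has its supremum of difference quotients below
  \<open>c\<close>. Any \<open>y\<close> in \<open>ball x r\<close> has a smaller ball inside
  \<open>ball x r\<close>, and shrinking the set of pairs can only lower the supremum, so the same
  bound holds at \<open>y\<close> (\<open>local_Lip_le\<close>). Hence strict sublevel sets contain
  a ball around each of their points.\<close>

lemma local_Lip_le:
  assumes "s > 0" "ball y s \<subseteq> ball x r"
  shows "local_Lip f y \<le> (SUP (u, v)\<in>{(u, v). u \<in> ball x r \<and> v \<in> ball x r \<and> u \<noteq> v}.
           ennreal (dist (f u) (f v) / dist u v))"
  unfolding local_Lip_def
proof (rule INF_lower2)
  show "s \<in> {0<..}"
    using assms(1) by simp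
  show "(SUP (u, v)\<in>{(u, v). u \<in> ball y s \<and> v \<in> ball y s \<and> u \<noteq> v}.
           ennreal (dist (f u) (f v) / dist u v))
      \<le> (SUP (u, v)\<in>{(u, v). u \<in> ball x r \<and> v \<in> ball x r \<and> u \<noteq> v}.
           ennreal (dist (f u) (f v) / dist u v))"
    using assms(2) by (intro SUP_subset_mono) auto
qed

lemma open_local_Lip_less: "open {x. local_Lip f x < c}"
proof (rule openI)
  fix x assume "x \<in> {x. local_Lip f x < c}"
  \<comment> \<open>The strict inequality yields a witness radius even when the infimum is not
    attained.\<close>
  then obtain r where r: "r > 0"
      "(SUP (u, v)\<in>{(u, v). u \<in> ball x r \<and> v \<in> ball x r \<and> u \<noteq> v}.
         ennreal (dist (f u) (f v) / dist u v)) < c"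
    unfolding local_Lip_def by (auto simp: INF_less_iff)
  have "local_Lip f y < c" if "y \<in> ball x r" for y
  proof -
    obtain s where "s > 0" "ball y s \<subseteq> ball x r"
      using \<open>y \<in> ball x r\<close> open_ball open_contains_ball by metis
    then show ?thesis
      by (rule le_less_trans[OF local_Lip_le r(2)])
  qed
  then show "\<exists>e>0. ball x e \<subseteq> {x. local_Lip f x < c}"
    using \<open>r > 0\<close> by blast
qed

text \<open>Carries real thresholds in \<open>ereal\<close> over to \<open>ennreal\<close>.
  Truncating a negative \<gamma> to 0 is harmless: no nonnegative value lies below either, so both
  sides are false.\<close>

lemma enn2ereal_less_ereal_iff: "enn2ereal a < ereal \<gamma> \<longleftrightarrow> a < ennreal \<gamma>"
proof (cases "\<gamma> \<ge> 0")
  case True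
  then show ?thesis
    by (simp add: less_ennreal.rep_eq enn2ereal_ennreal)
next
  case False
  moreover from this have "ereal \<gamma> < enn2ereal a"
    by (intro less_le_trans[OF _ enn2ereal_nonneg]) simp
  ultimately show ?thesis
    by (simp add: ennreal_neg not_less less_imp_le)
qed

theorem theorem5p5:
  fixes f :: "'a::metric_space \<Rightarrow> 'b::metric_space"
  shows "upper_semicontinuous (\<lambda>x. enn2ereal (local_Lip f x))"
  unfolding upper_semicontinuous_def
  by (simp add: vimage_def enn2ereal_less_ereal_iff open_local_Lip_less)

end
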